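(* Let $((M,\nabla),h)$ be a radiant Hessian manifold. Then $((M,\nabla^* ),h)$ is a Hessian manifold of Koszul type. In fact, if $H$ is an Euler vector field of $(M,\nabla)$, then $H^\flat$ is a $1$-form potential of $((M,\nabla^* ),h)$, where $\flat$ is the musical isomorphism with respect to $h$.
   Context: An affine manifold $(M,\nabla)$ is a connected smooth manifold $M$ without boundary with a flat and torsion-free connection $\nabla$ on its tangent bundle. A Hessian metric on $(M,\nabla)$ is a Riemannian metric $h$ on $M$ such that every point has an open neighbourhood $U$ and a function $f\in C^\infty(U)$ with $h|_U=\nabla(df)$; then $((M,\nabla),h)$ is called a Hessian manifold. It is of Koszul type if there is a global $1$-form $\eta\in\Omega^1(M)$ with $h=\nabla\eta$; such an $\eta$ is called a $1$-form potential. The conjugate connection $\nabla^*$ of $\nabla$ with respect to $h$ is the unique connection on $TM$ with $Zh(X,Y)=h(\nabla_ZX,Y)+h(X,\nabla^*_ZY)$ for all vector fields $X,Y,Z$. An Euler vector field of $(M,\nabla)$ is a vector field $H$ with $\nabla_XH=X$ for every vector field $X$; an affine manifold is radiant if it admits an Euler vector field, and a Hessian manifold is radiant if its underlying affine manifold is. *)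

theory Defs
  imports "HOL-Analysis.Analysis"
begin

section \<open>Smooth manifolds\<close>

text \<open>
  On an open subset of a finite-dimensional space, a function is of class C\<open>\<^sup>k\<close> iff it is
  differentiable and all its directional derivatives are of class C\<open>\<^sup>k\<^sup>-\<^sup>1\<close>.
\<close>

primrec Ck_on :: "nat \<Rightarrow> ('e::real_normed_vector \<Rightarrow> 'f::real_normed_vector) \<Rightarrow> 'e set \<Rightarrow> bool" where
  "Ck_on 0 f S \<longleftrightarrow> continuous_on S f"
| "Ck_on (Suc k) f S \<longleftrightarrow>
     (\<forall>x\<in>S. f differentiable (at x)) \<and> (\<forall>v. Ck_on k (\<lambda>x. frechet_derivative f (at x) v) S)"

definition smooth_on :: "('e::real_normed_vector \<Rightarrow> 'f::real_normed_vector) \<Rightarrow> 'e set \<Rightarrow> bool" where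
  "smooth_on f S \<longleftrightarrow> (\<forall>k. Ck_on k f S)"

text \<open>
  The points of the manifold are the elements of a type, and a chart is a pair of its domain
  and a map that only matters on this domain.
\<close>

type_synonym ('a, 'e) atlas = "('a set \<times> ('a \<Rightarrow> 'e)) set"

text \<open>
  A smooth structure is given by a (not necessarily maximal) smooth atlas.  The model space is a
  finite-dimensional inner product space, that is, a Euclidean space; the class
  \<^class>\<open>euclidean_space\<close> is not used because it excludes dimension 0.
\<close>

definition smooth_manifold ::
  "('a::{t2_space, second_countable_topology}, 'e::real_inner) atlas \<Rightarrow> bool" where
  "smooth_manifold A \<longleftrightarrow>
     (\<exists>B::'e set. finite B \<and> span B = UNIV) \<and>
     (\<forall>(U, \<phi>)\<in>A. open U \<and> open (\<phi> ` U) \<and> homeomorphism U (\<phi> ` U) \<phi> (inv_into U \<phi>)) \<and>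
     (\<Union>(U, \<phi>)\<in>A. U) = UNIV \<and>
     (\<forall>(U, \<phi>)\<in>A. \<forall>(V, \<psi>)\<in>A. smooth_on (\<psi> \<circ> inv_into U \<phi>) (\<phi> ` (U \<inter> V)))"

text \<open>Functions in C\<open>\<^sup>\<infinity>(W)\<close> for open \<open>W\<close> are total functions whose values off \<open>W\<close> are irrelevant.\<close>

definition smooth_fun ::
  "('a::topological_space, 'e::real_inner) atlas \<Rightarrow> 'a set \<Rightarrow> ('a \<Rightarrow> real) \<Rightarrow> bool" where
  "smooth_fun A W f \<longleftrightarrow> (\<forall>(U, \<phi>)\<in>A. smooth_on (f \<circ> inv_into U \<phi>) (\<phi> ` (W \<inter> U)))"

definition smooth_near ::
  "('a::topological_space, 'e::real_inner) atlas \<Rightarrow> 'a \<Rightarrow> ('a \<Rightarrow> real) \<Rightarrow> bool" where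
  "smooth_near A p f \<longleftrightarrow> (\<exists>W. open W \<and> p \<in> W \<and> smooth_fun A W f)"

section \<open>Tangent vectors, vector fields and one-forms\<close>

text \<open>
  Tangent vectors at \<open>p\<close> are the derivations at \<open>p\<close> of the algebra of germs of smooth functions.
  As operators on total functions they depend only on the germ at \<open>p\<close>, and they are extended by 0
  to functions that are not smooth near \<open>p\<close>, so that equal derivations are equal as operators.
\<close>

type_synonym 'a tvec = "('a \<Rightarrow> real) \<Rightarrow> real"

definition tangent_space ::
  "('a::topological_space, 'e::real_inner) atlas \<Rightarrow> 'a \<Rightarrow> 'a tvec set" where
  "tangent_space A p = {v.
     (\<forall>f g. smooth_near A p f \<and> smooth_near A p g \<and> (\<forall>\<^sub>F q in nhds p. f q = g q) \<longrightarrow> v f = v g) \<and>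
     (\<forall>f g a b. smooth_near A p f \<and> smooth_near A p g \<longrightarrow>
        v (\<lambda>q. a * f q + b * g q) = a * v f + b * v g) \<and>
     (\<forall>f g. smooth_near A p f \<and> smooth_near A p g \<longrightarrow>
        v (\<lambda>q. f q * g q) = v f * g p + f p * v g) \<and>
     (\<forall>f. \<not> smooth_near A p f \<longrightarrow> v f = 0)}"

type_synonym 'a vfield = "'a \<Rightarrow> 'a tvec"

definition vfields :: "('a::topological_space, 'e::real_inner) atlas \<Rightarrow> 'a vfield set" where
  "vfields A = {X. (\<forall>p. X p \<in> tangent_space A p) \<and>
     (\<forall>W f. open W \<and> smooth_fun A W f \<longrightarrow> smooth_fun A W (\<lambda>p. X p f))}"

definition vadd :: "'a vfield \<Rightarrow> 'a vfield \<Rightarrow> 'a vfield" where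
  "vadd X Y = (\<lambda>p g. X p g + Y p g)"

definition vscale :: "('a \<Rightarrow> real) \<Rightarrow> 'a vfield \<Rightarrow> 'a vfield" where
  "vscale f X = (\<lambda>p g. f p * X p g)"

text \<open>
  The case distinction is needed: the formula for the bracket can give a nonzero value on a
  function that is not smooth near \<open>p\<close>.
\<close>

definition lie_bracket ::
  "('a::topological_space, 'e::real_inner) atlas \<Rightarrow> 'a vfield \<Rightarrow> 'a vfield \<Rightarrow> 'a vfield" where
  "lie_bracket A X Y = (\<lambda>p g.
     if smooth_near A p g then X p (\<lambda>q. Y q g) - Y p (\<lambda>q. X q g) else 0)"

type_synonym 'a form1 = "'a \<Rightarrow> 'a tvec \<Rightarrow> real"

definition one_form ::
  "('a::topological_space, 'e::real_inner) atlas \<Rightarrow> 'a form1 \<Rightarrow> bool" where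
  "one_form A \<eta> \<longleftrightarrow>
     (\<forall>p. \<forall>v\<in>tangent_space A p. \<forall>w\<in>tangent_space A p. \<forall>a b.
        \<eta> p (\<lambda>g. a * v g + b * w g) = a * \<eta> p v + b * \<eta> p w) \<and>
     (\<forall>X\<in>vfields A. smooth_fun A UNIV (\<lambda>p. \<eta> p (X p)))"

definition differential :: "('a \<Rightarrow> real) \<Rightarrow> 'a form1" where
  "differential f = (\<lambda>p v. v f)"

section \<open>Affine connections and affine manifolds\<close>

text \<open>
  Connections are restricted to pairs of smooth vector fields (and undefined elsewhere), so
  that equality of connections is equality of functions.
\<close>

type_synonym 'a connection = "'a vfield \<Rightarrow> 'a vfield \<Rightarrow> 'a vfield"

definition connection_on ::
  "('a::topological_space, 'e::real_inner) atlas \<Rightarrow> 'a connection \<Rightarrow> bool" where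
  "connection_on A nab \<longleftrightarrow>
     nab \<in> vfields A \<rightarrow>\<^sub>E (vfields A \<rightarrow>\<^sub>E vfields A) \<and>
     (\<forall>X\<in>vfields A. \<forall>Y\<in>vfields A. \<forall>Z\<in>vfields A.
        nab (vadd X Y) Z = vadd (nab X Z) (nab Y Z) \<and>
        nab X (vadd Y Z) = vadd (nab X Y) (nab X Z)) \<and>
     (\<forall>X\<in>vfields A. \<forall>Y\<in>vfields A. \<forall>f. smooth_fun A UNIV f \<longrightarrow>
        nab (vscale f X) Y = vscale f (nab X Y) \<and>
        nab X (vscale f Y) = vadd (vscale (\<lambda>p. X p f) Y) (vscale f (nab X Y)))"

definition torsion_free ::
  "('a::topological_space, 'e::real_inner) atlas \<Rightarrow> 'a connection \<Rightarrow> bool" where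
  "torsion_free A nab \<longleftrightarrow> (\<forall>X\<in>vfields A. \<forall>Y\<in>vfields A. \<forall>p g.
     nab X Y p g - nab Y X p g = lie_bracket A X Y p g)"

definition flat_connection ::
  "('a::topological_space, 'e::real_inner) atlas \<Rightarrow> 'a connection \<Rightarrow> bool" where
  "flat_connection A nab \<longleftrightarrow> (\<forall>X\<in>vfields A. \<forall>Y\<in>vfields A. \<forall>Z\<in>vfields A. \<forall>p g.
     nab X (nab Y Z) p g - nab Y (nab X Z) p g - nab (lie_bracket A X Y) Z p g = 0)"

definition affine_manifold ::
  "('a::{t2_space, second_countable_topology}, 'e::real_inner) atlas \<Rightarrow> 'a connection \<Rightarrow> bool" where
  "affine_manifold A nab \<longleftrightarrow> smooth_manifold A \<and> connected (UNIV :: 'a set) \<and>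
     connection_on A nab \<and> flat_connection A nab \<and> torsion_free A nab"

text \<open>\<open>(\<nabla>\<eta>)(X, Y) = X(\<eta>(Y)) - \<eta>(\<nabla>\<^sub>X Y)\<close>; at \<open>p\<close> this only needs \<open>\<eta>\<close> to be a form near \<open>p\<close>.\<close>

definition cov_form ::
  "'a connection \<Rightarrow> 'a form1 \<Rightarrow> 'a vfield \<Rightarrow> 'a vfield \<Rightarrow> 'a \<Rightarrow> real" where
  "cov_form nab \<eta> X Y p = X p (\<lambda>q. \<eta> q (Y q)) - \<eta> p (nab X Y p)"

definition euler_field ::
  "('a::topological_space, 'e::real_inner) atlas \<Rightarrow> 'a connection \<Rightarrow> 'a vfield \<Rightarrow> bool" where
  "euler_field A nab H \<longleftrightarrow> H \<in> vfields A \<and> (\<forall>X\<in>vfields A. nab X H = X)"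

definition radiant ::
  "('a::topological_space, 'e::real_inner) atlas \<Rightarrow> 'a connection \<Rightarrow> bool" where
  "radiant A nab \<longleftrightarrow> (\<exists>H. euler_field A nab H)"

section \<open>Hessian metrics\<close>

type_synonym 'a metric = "'a \<Rightarrow> 'a tvec \<Rightarrow> 'a tvec \<Rightarrow> real"

definition riemannian_metric ::
  "('a::topological_space, 'e::real_inner) atlas \<Rightarrow> 'a metric \<Rightarrow> bool" where
  "riemannian_metric A h \<longleftrightarrow>
     (\<forall>p. \<forall>u\<in>tangent_space A p. \<forall>v\<in>tangent_space A p. \<forall>w\<in>tangent_space A p. \<forall>a b.
        h p (\<lambda>g. a * u g + b * v g) w = a * h p u w + b * h p v w) \<and>
     (\<forall>p. \<forall>v\<in>tangent_space A p. \<forall>w\<in>tangent_space A p. h p v w = h p w v) \<and>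
     (\<forall>p. \<forall>v\<in>tangent_space A p. v \<noteq> (\<lambda>g. 0) \<longrightarrow> h p v v > 0) \<and>
     (\<forall>X\<in>vfields A. \<forall>Y\<in>vfields A. smooth_fun A UNIV (\<lambda>p. h p (X p) (Y p)))"

text \<open>
  Both sides of \<open>h|\<^sub>U = \<nabla>(df)\<close> are tensors on \<open>U\<close>, and every tangent vector extends to a global
  vector field, so it is tested at the points of \<open>U\<close> on global vector fields.
\<close>

definition hessian_metric ::
  "('a::topological_space, 'e::real_inner) atlas \<Rightarrow> 'a connection \<Rightarrow> 'a metric \<Rightarrow> bool" where
  "hessian_metric A nab h \<longleftrightarrow> riemannian_metric A h \<and>
     (\<forall>p. \<exists>U f. open U \<and> p \<in> U \<and> smooth_fun A U f \<and>
        (\<forall>X\<in>vfields A. \<forall>Y\<in>vfields A. \<forall>q\<in>U.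
           h q (X q) (Y q) = cov_form nab (differential f) X Y q))"

definition hessian_manifold ::
  "('a::{t2_space, second_countable_topology}, 'e::real_inner) atlas \<Rightarrow>
    'a connection \<Rightarrow> 'a metric \<Rightarrow> bool" where
  "hessian_manifold A nab h \<longleftrightarrow> affine_manifold A nab \<and> hessian_metric A nab h"

definition one_form_potential ::
  "('a::topological_space, 'e::real_inner) atlas \<Rightarrow>
    'a connection \<Rightarrow> 'a metric \<Rightarrow> 'a form1 \<Rightarrow> bool" where
  "one_form_potential A nab h \<eta> \<longleftrightarrow> one_form A \<eta> \<and>
     (\<forall>X\<in>vfields A. \<forall>Y\<in>vfields A. \<forall>p. h p (X p) (Y p) = cov_form nab \<eta> X Y p)"

definition koszul_type ::
  "('a::{t2_space, second_countable_topology}, 'e::real_inner) atlas \<Rightarrow>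
    'a connection \<Rightarrow> 'a metric \<Rightarrow> bool" where
  "koszul_type A nab h \<longleftrightarrow> hessian_manifold A nab h \<and> (\<exists>\<eta>. one_form_potential A nab h \<eta>)"

definition conjugate_connection ::
  "('a::topological_space, 'e::real_inner) atlas \<Rightarrow>
    'a metric \<Rightarrow> 'a connection \<Rightarrow> 'a connection \<Rightarrow> bool" where
  "conjugate_connection A h nab nab' \<longleftrightarrow> connection_on A nab' \<and>
     (\<forall>X\<in>vfields A. \<forall>Y\<in>vfields A. \<forall>Z\<in>vfields A. \<forall>p.
        Z p (\<lambda>q. h q (X q) (Y q)) = h p (nab Z X p) (Y p) + h p (X p) (nab' Z Y p))"

lemma conjugate_connection_unique:
  assumes h: "riemannian_metric A h"
    and D: "conjugate_connection A h nab D" and D': "conjugate_connection A h nab D'"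
  shows "D = D'"
proof -
  have P: "D \<in> vfields A \<rightarrow>\<^sub>E (vfields A \<rightarrow>\<^sub>E vfields A)"
    and P': "D' \<in> vfields A \<rightarrow>\<^sub>E (vfields A \<rightarrow>\<^sub>E vfields A)"
    using D D' by (simp_all add: conjugate_connection_def connection_on_def)
  have eq: "D Z Y = D' Z Y" if Z: "Z \<in> vfields A" and Y: "Y \<in> vfields A" for Z Y
  proof
    fix p
    have 1: "D Z Y \<in> vfields A" "D' Z Y \<in> vfields A"
      using PiE_mem[OF PiE_mem[OF P Z] Y] PiE_mem[OF PiE_mem[OF P' Z] Y] .
    define u v where "u = D Z Y p" and "v = D' Z Y p"
    have uv: "u \<in> tangent_space A p" "v \<in> tangent_space A p"
      using 1 unfolding u_def v_def vfields_def by blast+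
    define w where "w = (\<lambda>g. 1 * u g + (-1) * v g)"
    have w: "w \<in> tangent_space A p"
    proof -
      have 1: "w f = w g"
        if "smooth_near A p f" "smooth_near A p g" "\<forall>\<^sub>F q in nhds p. f q = g q" for f g
      proof -
        have "u f = u g" "v f = v g"
          using uv(1)[unfolded tangent_space_def mem_Collect_eq, THEN conjunct1]
            uv(2)[unfolded tangent_space_def mem_Collect_eq, THEN conjunct1] that by blast+
        then show ?thesis by (simp add: w_def)
      qed
      have 2: "w (\<lambda>q. a * f q + b * g q) = a * w f + b * w g"
        if "smooth_near A p f" "smooth_near A p g" for f g a b
      proof -
        have "u (\<lambda>q. a * f q + b * g q) = a * u f + b * u g"
          "v (\<lambda>q. a * f q + b * g q) = a * v f + b * v g"
          using uv(1)[unfolded tangent_space_def mem_Collect_eq, THEN conjunct2, THEN conjunct1]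
            uv(2)[unfolded tangent_space_def mem_Collect_eq, THEN conjunct2, THEN conjunct1] that by blast+
        then show ?thesis by (simp add: w_def algebra_simps)
      qed
      have 3: "w (\<lambda>q. f q * g q) = w f * g p + f p * w g"
        if "smooth_near A p f" "smooth_near A p g" for f g
      proof -
        have "u (\<lambda>q. f q * g q) = u f * g p + f p * u g"
          "v (\<lambda>q. f q * g q) = v f * g p + f p * v g"
          using uv(1)[unfolded tangent_space_def mem_Collect_eq, THEN conjunct2, THEN conjunct2, THEN conjunct1]
            uv(2)[unfolded tangent_space_def mem_Collect_eq, THEN conjunct2, THEN conjunct2, THEN conjunct1] that by blast+
        then show ?thesis by (simp add: w_def algebra_simps)
      qed
      have 4: "w f = 0" if "\<not> smooth_near A p f" for f
      proof -
        have "u f = 0" "v f = 0"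
          using uv(1)[unfolded tangent_space_def mem_Collect_eq, THEN conjunct2, THEN conjunct2, THEN conjunct2]
            uv(2)[unfolded tangent_space_def mem_Collect_eq, THEN conjunct2, THEN conjunct2, THEN conjunct2] that by blast+
        then show ?thesis by (simp add: w_def)
      qed
      show ?thesis
        unfolding tangent_space_def mem_Collect_eq
        by (intro conjI allI impI; (elim conjE)?; (rule 1 | rule 2 | rule 3 | rule 4); assumption)
    qed
    have X: "h p (X p) u = h p (X p) v" if "X \<in> vfields A" for X
    proof -
      have "Z p (\<lambda>q. h q (X q) (Y q)) = h p (nab Z X p) (Y p) + h p (X p) u"
        "Z p (\<lambda>q. h q (X q) (Y q)) = h p (nab Z X p) (Y p) + h p (X p) v"
        unfolding u_def v_def
        using D[unfolded conjugate_connection_def, THEN conjunct2]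
          D'[unfolded conjugate_connection_def, THEN conjunct2] Z Y that by blast+
      then show ?thesis by simp
    qed
    have sym: "h p a b = h p b a" if "a \<in> tangent_space A p" "b \<in> tangent_space A p" for a b
      using h[unfolded riemannian_metric_def, THEN conjunct2, THEN conjunct1] that by blast
    have lin: "h p w a = h p u a - h p v a" if "a \<in> tangent_space A p" for a
    proof -
      have "h p w a = 1 * h p u a + (-1) * h p v a"
        unfolding w_def
        using h[unfolded riemannian_metric_def, THEN conjunct1] uv that by blast
      then show ?thesis by simp
    qed
    have "h p u u = h p u v" "h p v u = h p v v"
      using X[OF 1(1)] X[OF 1(2)] by (simp_all add: u_def v_def)
    then have "h p w w = 0"
      using lin[OF w] lin[OF uv(1)] lin[OF uv(2)] sym[OF uv(1) w] sym[OF uv(2) w]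
        sym[OF uv] by linarith
    then have "\<not> h p w w > 0" by simp
    then have "w = (\<lambda>g. 0)"
      using h[unfolded riemannian_metric_def, THEN conjunct2, THEN conjunct2, THEN conjunct1] w
      by blast
    then show "D Z Y p = D' Z Y p"
      by (simp add: w_def u_def v_def fun_eq_iff)
  qed
  show ?thesis
  proof (rule PiE_ext[OF P P'])
    fix Z assume Z: "Z \<in> vfields A"
    show "D Z = D' Z"
      by (rule PiE_ext[OF PiE_mem[OF P Z] PiE_mem[OF P' Z]]) (rule eq[OF Z])
  qed
qed

definition musical_flat :: "'a metric \<Rightarrow> 'a vfield \<Rightarrow> 'a form1" where
  "musical_flat h X = (\<lambda>p v. h p (X p) v)"

end

theory Submission
  imports Defs
begin

text \<open>
  No Poincare lemma is needed to integrate the closed form \<open>H\<^sup>\<flat>\<close>: if \<open>h = \<nabla>(df)\<close> on \<open>U\<close>, then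
  \<open>X(Hf - f) = (\<nabla>\<^sub>X df)(H) + df(\<nabla>\<^sub>X H) - Xf = h(X, H)\<close>, so the Legendre transform \<open>Hf - f\<close> is a
  primitive of \<open>H\<^sup>\<flat>\<close> on \<open>U\<close>.  Since \<open>(\<nabla>\<^sup>*H\<^sup>\<flat>)(X, Y) = X h(H, Y) - h(H, \<nabla>\<^sup>*\<^sub>X Y) = h(\<nabla>\<^sub>X H, Y) = h(X, Y)\<close>,
  it is a Hessian potential for \<open>\<nabla>\<^sup>*\<close>.  That \<open>\<nabla>\<^sup>*\<close> is flat and torsion-free follows by testing
  its curvature and torsion against arbitrary fields with \<open>h\<close>.
\<close>

section \<open>Linear combinations of smooth functions and vector fields\<close>

text \<open>On an open set the derivative at a point depends only on nearby values, all inside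
  \<open>S\<close>, so agreement on \<open>S\<close> passes to the derivatives and the induction can
  run over arbitrary \<open>f\<close> and \<open>g\<close>.\<close>

lemma Ck_on_cong:
  assumes "open S" "\<And>x. x \<in> S \<Longrightarrow> f x = g x" "Ck_on k f S"
  shows "Ck_on k g S"
  using assms(2,3)
proof (induction k arbitrary: f g)
  case 0
  then show ?case by (metis Ck_on.simps(1) continuous_on_cong)
next
  case (Suc k)
  have D: "(g has_derivative frechet_derivative f (at x)) (at x)" if x: "x \<in> S" for x
  proof -
    have "(f has_derivative frechet_derivative f (at x)) (at x)"
      using Suc.prems(2) x by (simp add: frechet_derivative_works)
    then show ?thesis
      by (rule has_derivative_transform_within_open[OF _ \<open>open S\<close> x]) (use Suc.prems(1) in auto)
  qed
  have eq: "frechet_derivative g (at x) = frechet_derivative f (at x)" if "x \<in> S" for x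
    using frechet_derivative_at[OF D[OF that]] by simp
  have df: "Ck_on k (\<lambda>x. frechet_derivative f (at x) v) S" for v
    using Suc.prems(2) by simp
  have "g differentiable (at x)" if "x \<in> S" for x
    using D[OF that] by (auto simp: differentiable_def)
  moreover have "Ck_on k (\<lambda>x. frechet_derivative g (at x) v) S" for v
    by (rule Suc.IH[OF _ df]) (simp add: eq)
  ultimately show ?case by simp
qed

text \<open>Differentiation commutes with linear combinations, but the formula for the derivative is
  known only on \<open>S\<close>; \<open>Ck_on_cong\<close> bridges that gap at each induction
  step.\<close>

lemma Ck_on_lincomb:
  fixes f g :: "'e::real_normed_vector \<Rightarrow> real"
  assumes "open S" "Ck_on k f S" "Ck_on k g S"
  shows "Ck_on k (\<lambda>x. a * f x + b * g x) S"
  using assms(2,3)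
proof (induction k arbitrary: f g)
  case 0
  then show ?case by (auto intro!: continuous_intros)
next
  case (Suc k)
  have D: "((\<lambda>x. a * f x + b * g x) has_derivative
      (\<lambda>v. a * frechet_derivative f (at x) v + b * frechet_derivative g (at x) v)) (at x)"
    if "x \<in> S" for x
  proof -
    have "(f has_derivative frechet_derivative f (at x)) (at x)"
      "(g has_derivative frechet_derivative g (at x)) (at x)"
      using Suc.prems that by (simp_all add: frechet_derivative_works)
    then show ?thesis
      by (intro has_derivative_add has_derivative_mult_right)
  qed
  have "Ck_on k (\<lambda>x. frechet_derivative (\<lambda>x. a * f x + b * g x) (at x) v) S" for v
  proof (rule Ck_on_cong[OF \<open>open S\<close>])
    show "Ck_on k (\<lambda>x. a * frechet_derivative f (at x) v + b * frechet_derivative g (at x) v) S"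
      using Suc by simp
  qed (simp add: frechet_derivative_at[OF D, symmetric])
  then show ?case
    using D by (auto simp: differentiable_def)
qed

text \<open>Supplies the openness that \<open>Ck_on_lincomb\<close> requires when smoothness is
  checked in a chart.\<close>

lemma open_chart_image:
  assumes "smooth_manifold A" "(U, \<phi>) \<in> A" "open W"
  shows "open (\<phi> ` (W \<inter> U))"
proof -
  have U: "open U" "open (\<phi> ` U)" "homeomorphism U (\<phi> ` U) \<phi> (inv_into U \<phi>)"
    using assms(1,2) by (auto simp: smooth_manifold_def)
  have "openin (top_of_set (\<phi> ` U)) (\<phi> ` (W \<inter> U))"
    using assms(3) U(1) by (intro homeomorphism_imp_open_map[OF U(3)]) (simp add: openin_open_eq open_Int)
  then show ?thesis
    using U(2) openin_open_trans by blast
qed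

lemma smooth_fun_lincomb:
  assumes "smooth_manifold A" "open W" "smooth_fun A W f" "smooth_fun A W g"
  shows "smooth_fun A W (\<lambda>p. a * f p + b * g p)"
  unfolding smooth_fun_def
proof clarify
  fix U \<phi> assume U: "(U, \<phi>) \<in> A"
  have "smooth_on (f \<circ> inv_into U \<phi>) (\<phi> ` (W \<inter> U))" "smooth_on (g \<circ> inv_into U \<phi>) (\<phi> ` (W \<inter> U))"
    using assms(3,4) U by (auto simp: smooth_fun_def)
  then show "smooth_on ((\<lambda>p. a * f p + b * g p) \<circ> inv_into U \<phi>) (\<phi> ` (W \<inter> U))"
    using Ck_on_lincomb[OF open_chart_image[OF assms(1) U assms(2)]]
    by (simp add: smooth_on_def o_def)
qed

lemma smooth_nearI:
  "open W \<Longrightarrow> p \<in> W \<Longrightarrow> smooth_fun A W f \<Longrightarrow> smooth_near A p f"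
  by (auto simp: smooth_near_def)

section \<open>Derivation rules for tangent vectors and closure of vector fields under linear
  combinations\<close>

lemma tangent_germ:
  "v \<in> tangent_space A p \<Longrightarrow> smooth_near A p f \<Longrightarrow> smooth_near A p g \<Longrightarrow>
    \<forall>\<^sub>F q in nhds p. f q = g q \<Longrightarrow> v f = v g"
  unfolding tangent_space_def by blast

lemma tangent_lincomb:
  "v \<in> tangent_space A p \<Longrightarrow> smooth_near A p f \<Longrightarrow> smooth_near A p g \<Longrightarrow>
    v (\<lambda>q. a * f q + b * g q) = a * v f + b * v g"
  unfolding tangent_space_def by blast

lemma tangent_mult:
  "v \<in> tangent_space A p \<Longrightarrow> smooth_near A p f \<Longrightarrow> smooth_near A p g \<Longrightarrow>
    v (\<lambda>q. f q * g q) = v f * g p + f p * v g"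
  unfolding tangent_space_def by blast

lemma tangent_not_smooth:
  "v \<in> tangent_space A p \<Longrightarrow> \<not> smooth_near A p f \<Longrightarrow> v f = 0"
  unfolding tangent_space_def by blast

lemma tangent_add:
  "v \<in> tangent_space A p \<Longrightarrow> smooth_near A p f \<Longrightarrow> smooth_near A p g \<Longrightarrow>
    v (\<lambda>q. f q + g q) = v f + v g"
  using tangent_lincomb[of v A p f g 1 1] by simp

lemma tangent_diff:
  "v \<in> tangent_space A p \<Longrightarrow> smooth_near A p f \<Longrightarrow> smooth_near A p g \<Longrightarrow>
    v (\<lambda>q. f q - g q) = v f - v g"
  using tangent_lincomb[of v A p f g 1 "-1"] by simp

lemma tangent_space_lincomb:
  assumes u: "u \<in> tangent_space A p" and v: "v \<in> tangent_space A p"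
  shows "(\<lambda>g. a * u g + b * v g) \<in> tangent_space A p"
  unfolding tangent_space_def mem_Collect_eq
proof (intro conjI allI impI; (elim conjE)?)
  fix f g :: "'a \<Rightarrow> real"
  assume f: "smooth_near A p f" and g: "smooth_near A p g"
  show "a * u f + b * v f = a * u g + b * v g" if "\<forall>\<^sub>F q in nhds p. f q = g q"
    using tangent_germ[OF u f g that] tangent_germ[OF v f g that] by simp
  show "a * u (\<lambda>q. c * f q + d * g q) + b * v (\<lambda>q. c * f q + d * g q) =
      c * (a * u f + b * v f) + d * (a * u g + b * v g)" for c d
    using tangent_lincomb[OF u f g] tangent_lincomb[OF v f g] by (simp add: algebra_simps)
  show "a * u (\<lambda>q. f q * g q) + b * v (\<lambda>q. f q * g q) =
      (a * u f + b * v f) * g p + f p * (a * u g + b * v g)"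
    using tangent_mult[OF u f g] tangent_mult[OF v f g] by (simp add: algebra_simps)
next
  fix f assume "\<not> smooth_near A p f"
  then show "a * u f + b * v f = 0"
    using tangent_not_smooth[OF u] tangent_not_smooth[OF v] by simp
qed

lemma vfields_tangent: "X \<in> vfields A \<Longrightarrow> X p \<in> tangent_space A p"
  unfolding vfields_def by blast

lemma vfields_smooth:
  "X \<in> vfields A \<Longrightarrow> open W \<Longrightarrow> smooth_fun A W f \<Longrightarrow> smooth_fun A W (\<lambda>p. X p f)"
  unfolding vfields_def by blast

lemma vfields_lincomb:
  assumes "smooth_manifold A" "X \<in> vfields A" "Y \<in> vfields A"
  shows "(\<lambda>p g. a * X p g + b * Y p g) \<in> vfields A"
  unfolding vfields_def mem_Collect_eq
proof (intro conjI allI impI; (elim conjE)?)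
  show "(\<lambda>g. a * X p g + b * Y p g) \<in> tangent_space A p" for p
    using assms(2,3) by (intro tangent_space_lincomb vfields_tangent)
  show "smooth_fun A W (\<lambda>p. a * X p f + b * Y p f)" if "open W" "smooth_fun A W f" for W f
    by (rule smooth_fun_lincomb[OF assms(1) that(1) vfields_smooth[OF assms(2) that]
          vfields_smooth[OF assms(3) that]])
qed

text \<open>Makes curvature and torsion expressions genuine vector fields, to which
  \<open>metric_nondegenerate\<close> can be applied.\<close>

lemma vfields_diff:
  assumes "smooth_manifold A" "X \<in> vfields A" "Y \<in> vfields A"
  shows "(\<lambda>p g. X p g - Y p g) \<in> vfields A"
  using vfields_lincomb[OF assms, of 1 "-1"] by simp

lemma connection_vfields:
  "connection_on A nab \<Longrightarrow> X \<in> vfields A \<Longrightarrow> Y \<in> vfields A \<Longrightarrow> nab X Y \<in> vfields A"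
  unfolding connection_on_def by (blast dest: PiE_mem)

text \<open>Torsion-freeness writes the bracket as \<open>nab X Y - nab Y X\<close>, so the
  derivation property and smoothness come from the connection instead of a computation with second
  derivatives.\<close>

lemma lie_bracket_vfields:
  assumes "affine_manifold A nab" "X \<in> vfields A" "Y \<in> vfields A"
  shows "lie_bracket A X Y \<in> vfields A"
proof -
  have "lie_bracket A X Y = (\<lambda>p g. nab X Y p g - nab Y X p g)"
    using assms by (auto simp: affine_manifold_def torsion_free_def fun_eq_iff)
  moreover have sm: "smooth_manifold A" and c: "connection_on A nab"
    using assms(1) by (auto simp: affine_manifold_def)
  have "(\<lambda>p g. nab X Y p g - nab Y X p g) \<in> vfields A"
    by (rule vfields_diff[OF sm connection_vfields[OF c assms(2,3)] connection_vfields[OF c assms(3,2)]])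
  ultimately show ?thesis by simp
qed

lemma lie_bracket_smooth:
  "smooth_near A p g \<Longrightarrow> lie_bracket A X Y p g = X p (\<lambda>q. Y q g) - Y p (\<lambda>q. X q g)"
  by (simp add: lie_bracket_def)

section \<open>Metrics\<close>

lemma metric_sym:
  "riemannian_metric A h \<Longrightarrow> v \<in> tangent_space A p \<Longrightarrow> w \<in> tangent_space A p \<Longrightarrow> h p v w = h p w v"
  unfolding riemannian_metric_def by blast

lemma metric_smooth:
  "riemannian_metric A h \<Longrightarrow> X \<in> vfields A \<Longrightarrow> Y \<in> vfields A \<Longrightarrow>
    smooth_fun A UNIV (\<lambda>p. h p (X p) (Y p))"
  unfolding riemannian_metric_def by blast

lemma metric_smooth_near:
  "riemannian_metric A h \<Longrightarrow> X \<in> vfields A \<Longrightarrow> Y \<in> vfields A \<Longrightarrow>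
    smooth_near A p (\<lambda>p. h p (X p) (Y p))"
  using smooth_nearI[OF open_UNIV UNIV_I] metric_smooth by blast

lemma metric_lincomb_left:
  "riemannian_metric A h \<Longrightarrow> u \<in> tangent_space A p \<Longrightarrow> v \<in> tangent_space A p \<Longrightarrow>
    w \<in> tangent_space A p \<Longrightarrow> h p (\<lambda>g. a * u g + b * v g) w = a * h p u w + b * h p v w"
  unfolding riemannian_metric_def by blast

text \<open>Linearity is postulated in the first slot only; symmetry carries it to the
  second.\<close>

lemma metric_lincomb_right:
  assumes "riemannian_metric A h"
    "u \<in> tangent_space A p" "v \<in> tangent_space A p" "w \<in> tangent_space A p"
  shows "h p w (\<lambda>g. a * u g + b * v g) = a * h p w u + b * h p w v"
  using metric_lincomb_left[OF assms] metric_sym[OF assms(1) assms(4) assms(2)]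
    metric_sym[OF assms(1) assms(4) assms(3)]
    metric_sym[OF assms(1) assms(4) tangent_space_lincomb[OF assms(2,3)]]
  by simp

lemma metric_diff_left:
  assumes "riemannian_metric A h"
    "u \<in> tangent_space A p" "v \<in> tangent_space A p" "w \<in> tangent_space A p"
  shows "h p (\<lambda>g. u g - v g) w = h p u w - h p v w"
  using metric_lincomb_left[OF assms, of 1 "-1"] by simp

lemma metric_diff_right:
  assumes "riemannian_metric A h"
    "u \<in> tangent_space A p" "v \<in> tangent_space A p" "w \<in> tangent_space A p"
  shows "h p w (\<lambda>g. u g - v g) = h p w u - h p w v"
  using metric_lincomb_right[OF assms, of 1 "-1"] by simp

text \<open>Testing against \<open>X\<close> itself gives \<open>h p (X p) (X p) = 0\<close>, and
  positive definiteness does the rest; no tangent vector has to be extended to a field.\<close>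

lemma metric_nondegenerate:
  assumes "riemannian_metric A h" "X \<in> vfields A"
    and "\<And>Z p. Z \<in> vfields A \<Longrightarrow> h p (Z p) (X p) = 0"
  shows "X p = (\<lambda>g. 0)"
proof -
  have "\<not> h p (X p) (X p) > 0"
    using assms(3)[OF assms(2)] by simp
  then show ?thesis
    using assms(1) vfields_tangent[OF assms(2)] unfolding riemannian_metric_def by blast
qed

lemma hessian_metric_potential:
  assumes "hessian_metric A nab h"
  obtains U f where "open U" "p \<in> U" "smooth_fun A U f"
    "\<And>X Y q. X \<in> vfields A \<Longrightarrow> Y \<in> vfields A \<Longrightarrow> q \<in> U \<Longrightarrow>
      h q (X q) (Y q) = X q (\<lambda>r. Y r f) - nab X Y q f"
proof -
  have "\<exists>U f. open U \<and> p \<in> U \<and> smooth_fun A U f \<and>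
      (\<forall>X\<in>vfields A. \<forall>Y\<in>vfields A. \<forall>q\<in>U. h q (X q) (Y q) = X q (\<lambda>r. Y r f) - nab X Y q f)"
    using assms by (simp add: hessian_metric_def cov_form_def differential_def)
  then show ?thesis
    by (elim exE conjE) (rule that, auto)
qed

section \<open>The conjugate connection\<close>

lemma conjugate_eq:
  "conjugate_connection A h nab nab' \<Longrightarrow> X \<in> vfields A \<Longrightarrow> Y \<in> vfields A \<Longrightarrow> Z \<in> vfields A \<Longrightarrow>
    Z p (\<lambda>q. h q (X q) (Y q)) = h p (nab Z X p) (Y p) + h p (X p) (nab' Z Y p)"
  unfolding conjugate_connection_def by blast

text \<open>The curvatures are related by \<open>h(R(X, Y)Z, W) + h(Z, R\<^sup>*(X, Y)W) = 0\<close>.\<close>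

lemma flat_conjugate:
  assumes M: "affine_manifold A nab" and h: "riemannian_metric A h"
    and D: "conjugate_connection A h nab nab'"
  shows "flat_connection A nab'"
  unfolding flat_connection_def
proof (intro ballI allI)
  fix X Y W p g
  assume X: "X \<in> vfields A" and Y: "Y \<in> vfields A" and W: "W \<in> vfields A"
  have sm: "smooth_manifold A" and c: "connection_on A nab" and c': "connection_on A nab'"
    and flat: "flat_connection A nab"
    using M D by (auto simp: affine_manifold_def conjugate_connection_def)
  note V = connection_vfields[OF c] connection_vfields[OF c'] lie_bracket_vfields[OF M] X Y W
  note T = vfields_tangent
  \<comment> \<open>Conjugacy is used twice. The two mixed terms are together symmetric in
    \<open>P\<close> and \<open>Q\<close>, so they cancel in the commutator of \<open>X\<close> and
    \<open>Y\<close>.\<close>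
  have second: "P p (\<lambda>q. Q q (\<lambda>r. h r (Z r) (W r))) =
      h p (nab P (nab Q Z) p) (W p) + h p (nab Q Z p) (nab' P W p) +
      h p (nab P Z p) (nab' Q W p) + h p (Z p) (nab' P (nab' Q W) p)"
    if P: "P \<in> vfields A" and Q: "Q \<in> vfields A" and Z: "Z \<in> vfields A" for P Q Z p
  proof -
    have "P p (\<lambda>q. Q q (\<lambda>r. h r (Z r) (W r))) =
        P p (\<lambda>q. h q (nab Q Z q) (W q) + h q (Z q) (nab' Q W q))"
      using conjugate_eq[OF D Z W Q] by simp
    also have "\<dots> = P p (\<lambda>q. h q (nab Q Z q) (W q)) + P p (\<lambda>q. h q (Z q) (nab' Q W q))"
      by (rule tangent_add[OF T[OF P] metric_smooth_near[OF h V(1)[OF Q Z] W]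
            metric_smooth_near[OF h Z V(2)[OF Q W]]])
    also have "\<dots> = (h p (nab P (nab Q Z) p) (W p) + h p (nab Q Z p) (nab' P W p)) +
      (h p (nab P Z p) (nab' Q W p) + h p (Z p) (nab' P (nab' Q W) p))"
      by (simp only: conjugate_eq[OF D V(1)[OF Q Z] W P] conjugate_eq[OF D Z V(2)[OF Q W] P])
    finally show ?thesis by simp
  qed
  define L where "L = lie_bracket A X Y"
  have L: "L \<in> vfields A" using V by (simp add: L_def)
  note XYW = V(2)[OF X V(2)[OF Y W]] and YXW = V(2)[OF Y V(2)[OF X W]]
  \<comment> \<open>The curvature of \<open>nab'\<close> applied to \<open>W\<close>, as one
    field.\<close>
  define R where "R = (\<lambda>p g. (nab' X (nab' Y W) p g - nab' Y (nab' X W) p g) - nab' L W p g)"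
  have R: "R \<in> vfields A"
    unfolding R_def by (rule vfields_diff[OF sm vfields_diff[OF sm XYW YXW] V(2)[OF L W]])
  have "h p (Z p) (R p) = 0" if Z: "Z \<in> vfields A" for Z p
  proof -
    have flatZ: "nab L Z p = (\<lambda>g. nab X (nab Y Z) p g - nab Y (nab X Z) p g)"
      using flat X Y Z unfolding flat_connection_def L_def by fastforce
    have hR: "h p (Z p) (R p) = h p (Z p) (nab' X (nab' Y W) p) -
        h p (Z p) (nab' Y (nab' X W) p) - h p (Z p) (nab' L W p)"
      unfolding R_def
      using metric_diff_right[OF h T[OF vfields_diff[OF sm XYW YXW]] T[OF V(2)[OF L W]] T[OF Z]]
        metric_diff_right[OF h T[OF XYW] T[OF YXW] T[OF Z]] by simp
    \<comment> \<open>The function \<open>h(Z, W)\<close> is smooth, so the bracket acts on it as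
      the commutator and not by its default value 0.\<close>
    have "L p (\<lambda>q. h q (Z q) (W q)) =
        X p (\<lambda>q. Y q (\<lambda>r. h r (Z r) (W r))) - Y p (\<lambda>q. X q (\<lambda>r. h r (Z r) (W r)))"
      unfolding L_def by (rule lie_bracket_smooth[OF metric_smooth_near[OF h Z W]])
    moreover have "L p (\<lambda>q. h q (Z q) (W q)) = h p (nab L Z p) (W p) + h p (Z p) (nab' L W p)"
      by (rule conjugate_eq[OF D Z W L])
    moreover have "h p (nab L Z p) (W p) =
        h p (nab X (nab Y Z) p) (W p) - h p (nab Y (nab X Z) p) (W p)"
      unfolding flatZ
      by (rule metric_diff_left[OF h T[OF V(1)[OF X V(1)[OF Y Z]]] T[OF V(1)[OF Y V(1)[OF X Z]]] T[OF W]])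
    ultimately show ?thesis
      using hR second[OF X Y Z] second[OF Y X Z] by simp
  qed
  then have "R p = (\<lambda>g. 0)" by (rule metric_nondegenerate[OF h R])
  then show "nab' X (nab' Y W) p g - nab' Y (nab' X W) p g - nab' (lie_bracket A X Y) W p g = 0"
    by (simp add: R_def L_def fun_eq_iff)
qed

text \<open>
  In terms of a local potential, \<open>X h(Z, Y) - h(\<nabla>\<^sub>X Z, Y)\<close> antisymmetrised in \<open>X\<close>, \<open>Y\<close> is
  \<open>[X, Y]Zf - (\<nabla>\<^sub>X\<nabla>\<^sub>Y Z - \<nabla>\<^sub>Y\<nabla>\<^sub>X Z)f\<close>, which by flatness of \<open>\<nabla>\<close> equals \<open>h([X, Y], Z)\<close>.
\<close>

lemma torsion_free_conjugate:
  assumes M: "affine_manifold A nab" and hess: "hessian_metric A nab h"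
    and D: "conjugate_connection A h nab nab'"
  shows "torsion_free A nab'"
  unfolding torsion_free_def
proof (intro ballI allI)
  fix X Y p g
  assume X: "X \<in> vfields A" and Y: "Y \<in> vfields A"
  have h: "riemannian_metric A h" using hess by (simp add: hessian_metric_def)
  have sm: "smooth_manifold A" and c: "connection_on A nab" and c': "connection_on A nab'"
    and flat: "flat_connection A nab"
    using M D by (auto simp: affine_manifold_def conjugate_connection_def)
  note V = connection_vfields[OF c] connection_vfields[OF c'] lie_bracket_vfields[OF M] X Y
  note T = vfields_tangent
  define L where "L = lie_bracket A X Y"
  have L: "L \<in> vfields A" using V by (simp add: L_def)
  \<comment> \<open>The torsion of \<open>nab'\<close>, as one field.\<close>
  define S where "S = (\<lambda>p g. (nab' X Y p g - nab' Y X p g) - L p g)"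
  have S: "S \<in> vfields A"
    unfolding S_def by (rule vfields_diff[OF sm vfields_diff[OF sm V(2)[OF X Y] V(2)[OF Y X]] L])
  have "h p (Z p) (S p) = 0" if Z: "Z \<in> vfields A" for Z p
  proof -
    obtain U f where U: "open U" "p \<in> U" and f: "smooth_fun A U f"
      and pot: "\<And>P Q q. P \<in> vfields A \<Longrightarrow> Q \<in> vfields A \<Longrightarrow> q \<in> U \<Longrightarrow>
        h q (P q) (Q q) = P q (\<lambda>r. Q r f) - nab P Q q f"
      by (rule hessian_metric_potential[OF hess, of p]) (rule that, auto)
    have smn: "smooth_near A p (\<lambda>q. Q q f)" if "Q \<in> vfields A" for Q
      using smooth_nearI[OF U vfields_smooth[OF that U(1) f]] .
    \<comment> \<open>Symmetry lets \<open>Q\<close> differentiate first, so that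
      \<open>nab Q Z\<close> appears in the potential formula. That formula holds only on
      \<open>U\<close>, which is enough because \<open>P p\<close> sees only germs.\<close>
    have deriv: "P p (\<lambda>q. h q (Z q) (Q q)) =
        P p (\<lambda>q. Q q (\<lambda>r. Z r f)) - P p (\<lambda>q. nab Q Z q f)"
      if P: "P \<in> vfields A" and Q: "Q \<in> vfields A" for P Q
    proof -
      have s: "smooth_near A p (\<lambda>q. Q q (\<lambda>r. Z r f))"
        using smooth_nearI[OF U vfields_smooth[OF Q U(1) vfields_smooth[OF Z U(1) f]]] .
      have "smooth_fun A U (\<lambda>q. 1 * Q q (\<lambda>r. Z r f) + (-1) * nab Q Z q f)"
        by (rule smooth_fun_lincomb[OF sm U(1) vfields_smooth[OF Q U(1) vfields_smooth[OF Z U(1) f]]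
              vfields_smooth[OF V(1)[OF Q Z] U(1) f]])
      then have "smooth_near A p (\<lambda>q. Q q (\<lambda>r. Z r f) - nab Q Z q f)"
        using smooth_nearI[OF U] by simp
      moreover have "\<forall>\<^sub>F q in nhds p. h q (Z q) (Q q) = Q q (\<lambda>r. Z r f) - nab Q Z q f"
        unfolding eventually_nhds using U pot[OF Q Z] metric_sym[OF h T[OF Q] T[OF Z]] by metis
      ultimately have "P p (\<lambda>q. h q (Z q) (Q q)) = P p (\<lambda>q. Q q (\<lambda>r. Z r f) - nab Q Z q f)"
        using tangent_germ[OF T[OF P] metric_smooth_near[OF h Z Q]] by blast
      then show ?thesis
        using tangent_diff[OF T[OF P] s smn[OF V(1)[OF Q Z]]] by simp
    qed
    have conj: "h p (Z p) (nab' P Q p) = P p (\<lambda>q. h q (Z q) (Q q)) - h p (Q p) (nab P Z p)"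
      if P: "P \<in> vfields A" and Q: "Q \<in> vfields A" for P Q
      using conjugate_eq[OF D Z Q P] metric_sym[OF h T[OF V(1)[OF P Z]] T[OF Q]] by simp
    have "h p (Z p) (S p) = h p (Z p) (nab' X Y p) - h p (Z p) (nab' Y X p) - h p (Z p) (L p)"
      unfolding S_def
      using metric_diff_right[OF h T[OF vfields_diff[OF sm V(2)[OF X Y] V(2)[OF Y X]]] T[OF L] T[OF Z]]
        metric_diff_right[OF h T[OF V(2)[OF X Y]] T[OF V(2)[OF Y X]] T[OF Z]] by simp
    moreover have "h p (Z p) (L p) = L p (\<lambda>q. Z q f) - nab L Z p f"
      using metric_sym[OF h T[OF Z] T[OF L]] pot[OF L Z U(2)] by simp
    moreover have "nab L Z p f = nab X (nab Y Z) p f - nab Y (nab X Z) p f"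
      using flat X Y Z unfolding flat_connection_def L_def by fastforce
    moreover have "L p (\<lambda>q. Z q f) = X p (\<lambda>q. Y q (\<lambda>r. Z r f)) - Y p (\<lambda>q. X q (\<lambda>r. Z r f))"
      unfolding L_def by (rule lie_bracket_smooth[OF smn[OF Z]])
    \<comment> \<open>The terms \<open>X((nab Y Z)f)\<close> and \<open>Y((nab X Z)f)\<close> from
      \<open>deriv\<close> cancel against those from expanding \<open>h(X, nab Y Z)\<close> and
      \<open>h(Y, nab X Z)\<close> by \<open>pot\<close>. What remains is
      \<open>L(Zf) - (nab L Z)f - h(L, Z)\<close>, which is 0.\<close>
    ultimately show ?thesis
      using conj[OF X Y] conj[OF Y X] deriv[OF X Y] deriv[OF Y X]
        pot[OF Y V(1)[OF X Z] U(2)] pot[OF X V(1)[OF Y Z] U(2)] by simp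
  qed
  then have "S p = (\<lambda>g. 0)" by (rule metric_nondegenerate[OF h S])
  then show "nab' X Y p g - nab' Y X p g = lie_bracket A X Y p g"
    by (simp add: S_def L_def fun_eq_iff)
qed

section \<open>Euler fields and potentials for the conjugate connection\<close>

lemma euler_flat_potential:
  assumes h: "riemannian_metric A h" and D: "conjugate_connection A h nab nab'"
    and H: "euler_field A nab H"
  shows "one_form_potential A nab' h (musical_flat h H)"
  unfolding one_form_potential_def
proof (intro conjI ballI allI)
  have HV: "H \<in> vfields A" using H by (simp add: euler_field_def)
  show "one_form A (musical_flat h H)"
    using metric_lincomb_right[OF h _ _ vfields_tangent[OF HV]] metric_smooth[OF h HV]
    by (auto simp: one_form_def musical_flat_def)
  show "h p (X p) (Y p) = cov_form nab' (musical_flat h H) X Y p"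
    if X: "X \<in> vfields A" and Y: "Y \<in> vfields A" for X Y p
    \<comment> \<open>Here \<open>H\<close> sits in the slot differentiated by \<open>nab\<close>,
      where \<open>nab X H\<close> collapses to \<open>X\<close>.\<close>
    using conjugate_eq[OF D HV Y X, of p] H X
    by (simp add: cov_form_def musical_flat_def euler_field_def)
qed

lemma euler_flat_primitive:
  assumes h: "riemannian_metric A h" and H: "euler_field A nab H"
    and U: "open U" and f: "smooth_fun A U f"
    and pot: "\<And>X Y q. X \<in> vfields A \<Longrightarrow> Y \<in> vfields A \<Longrightarrow> q \<in> U \<Longrightarrow>
      h q (X q) (Y q) = X q (\<lambda>r. Y r f) - nab X Y q f"
    and X: "X \<in> vfields A" and q: "q \<in> U"
  shows "X q (\<lambda>r. H r f - f r) = h q (H q) (X q)"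
proof -
  have HV: "H \<in> vfields A" and XH: "nab X H = X" using H X by (auto simp: euler_field_def)
  have "X q (\<lambda>r. H r f - f r) = X q (\<lambda>r. H r f) - X q f"
    using tangent_diff[OF vfields_tangent[OF X] smooth_nearI[OF U q vfields_smooth[OF HV U f]]
      smooth_nearI[OF U q f]] .
  \<comment> \<open>With \<open>H\<close> in the second slot of \<open>pot\<close>, the correction
    term \<open>nab X H q f\<close> is exactly \<open>X q f\<close>.\<close>
  also have "\<dots> = h q (X q) (H q)"
    using pot[OF X HV q] XH by simp
  finally show ?thesis
    using metric_sym[OF h vfields_tangent[OF HV] vfields_tangent[OF X]] by simp
qed

text \<open>On \<open>U\<close> the forms \<open>dF\<close> and the flat of \<open>H\<close> agree
  on vector fields, hence so do their covariant derivatives under \<open>nab'\<close>, and the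
  latter form is already known to be a potential.\<close>

lemma hessian_metric_conjugate:
  assumes M: "affine_manifold A nab" and hess: "hessian_metric A nab h"
    and D: "conjugate_connection A h nab nab'" and H: "euler_field A nab H"
  shows "hessian_metric A nab' h"
  unfolding hessian_metric_def
proof (intro conjI allI)
  show h: "riemannian_metric A h" using hess by (simp add: hessian_metric_def)
  fix p
  obtain U f where U: "open U" "p \<in> U" and f: "smooth_fun A U f"
    and pot: "\<And>X Y q. X \<in> vfields A \<Longrightarrow> Y \<in> vfields A \<Longrightarrow> q \<in> U \<Longrightarrow>
      h q (X q) (Y q) = X q (\<lambda>r. Y r f) - nab X Y q f"
    by (rule hessian_metric_potential[OF hess, of p]) (rule that, auto)
  have sm: "smooth_manifold A" and c': "connection_on A nab'" and HV: "H \<in> vfields A"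
    using M D H by (auto simp: affine_manifold_def conjugate_connection_def euler_field_def)
  define F where "F = (\<lambda>r. H r f - f r)"
  have F: "smooth_fun A U F"
    using smooth_fun_lincomb[OF sm U(1) vfields_smooth[OF HV U(1) f] f, of 1 "-1"]
    by (simp add: F_def)
  have prim: "X q F = h q (H q) (X q)" if "X \<in> vfields A" "q \<in> U" for X q
    unfolding F_def by (rule euler_flat_primitive[OF h H U(1) f pot that])
  have "h q (X q) (Y q) = cov_form nab' (differential F) X Y q"
    if X: "X \<in> vfields A" and Y: "Y \<in> vfields A" and q: "q \<in> U" for X Y q
  proof -
    \<comment> \<open>Agreement near \<open>q\<close> is needed, not just at \<open>q\<close>,
      because the first term of \<open>cov_form\<close> differentiates; the second term needs only
      the value at \<open>q\<close>.\<close>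
    have "\<forall>\<^sub>F r in nhds q. Y r F = h r (H r) (Y r)"
      unfolding eventually_nhds using U(1) q prim[OF Y] by blast
    then have "X q (\<lambda>r. Y r F) = X q (\<lambda>r. h r (H r) (Y r))"
      using tangent_germ[OF vfields_tangent[OF X] smooth_nearI[OF U(1) q vfields_smooth[OF Y U(1) F]]
        metric_smooth_near[OF h HV Y]] by blast
    then have "cov_form nab' (differential F) X Y q = cov_form nab' (musical_flat h H) X Y q"
      using prim[OF connection_vfields[OF c' X Y] q]
      by (simp add: cov_form_def differential_def musical_flat_def)
    then show ?thesis
      using euler_flat_potential[OF h D H] X Y by (simp add: one_form_potential_def)
  qed
  then show "\<exists>U f. open U \<and> p \<in> U \<and> smooth_fun A U f \<and> (\<forall>X\<in>vfields A. \<forall>Y\<in>vfields A. \<forall>q\<in>U.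
      h q (X q) (Y q) = cov_form nab' (differential f) X Y q)"
    using U F by blast
qed

theorem proposition3p9:
  fixes A :: "('a::{t2_space, second_countable_topology}, 'e::real_inner) atlas"
    and nab nab' :: "'a connection" and h :: "'a metric"
  assumes "hessian_manifold A nab h"
    and "radiant A nab"
    and "conjugate_connection A h nab nab'"
  shows "hessian_manifold A nab' h \<and> koszul_type A nab' h \<and>
    (\<forall>H. euler_field A nab H \<longrightarrow> one_form_potential A nab' h (musical_flat h H))"
proof -
  have M: "affine_manifold A nab" and hess: "hessian_metric A nab h" and h: "riemannian_metric A h"
    using assms(1) by (auto simp: hessian_manifold_def hessian_metric_def)
  \<comment> \<open>One Euler field suffices for the Hessian property and Koszul type; the last
    conjunct follows for each Euler field from \<open>euler_flat_potential\<close>.\<close>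
  obtain H where H: "euler_field A nab H"
    using assms(2) by (auto simp: radiant_def)
  have "affine_manifold A nab'"
    using M assms(3) flat_conjugate[OF M h assms(3)] torsion_free_conjugate[OF M hess assms(3)]
    by (simp add: affine_manifold_def conjugate_connection_def)
  then have "hessian_manifold A nab' h"
    using hessian_metric_conjugate[OF M hess assms(3) H] by (simp add: hessian_manifold_def)
  then show ?thesis
    using euler_flat_potential[OF h assms(3)] H by (auto simp: koszul_type_def)
qed

end
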